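(* Let $(\mathfrak g_i,\langle\cdot,\cdot\rangle_i)$, $i=1,2$, be metric Lie algebras with Levi-Civita products $\nabla^i$, and put $D_i=\nabla^i_{\mathfrak g_i}\mathfrak g_i$. Let $B:\mathfrak g_1\times\mathfrak g_2\to\mathbb R$ be a bilinear form, and suppose that the symmetric bilinear form $$\langle X_1+X_2,Y_1+Y_2\rangle_B=\langle X_1,Y_1\rangle_1+\langle X_2,Y_2\rangle_2+B(X_1,Y_2)+B(Y_1,X_2)\qquad (X_i,Y_i\in\mathfrak g_i)$$ is non-degenerate on the direct sum Lie algebra $\mathfrak g=\mathfrak g_1\oplus\mathfrak g_2$. Then both summands $\mathfrak g_1$ and $\mathfrak g_2$ are strong ideals of $(\mathfrak g,\langle\cdot,\cdot\rangle_B)$ if and only if $$B(D_1,\mathfrak g_2)=0\quad\text{and}\quad B(\mathfrak g_1,D_2)=0.$$ In this case the Levi-Civita product of $(\mathfrak g,\langle\cdot,\cdot\rangle_B)$ is $\nabla^1\oplus\nabla^2$, i.e. $\nabla_{X_1+X_2}(Y_1+Y_2)=\nabla^1_{X_1}Y_1+\nabla^2_{X_2}Y_2$.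
   Context: A metric Lie algebra is a finite-dimensional real Lie algebra $\mathfrak g$ with a non-degenerate symmetric bilinear form $\langle\cdot,\cdot\rangle$ (of arbitrary signature). Its Levi-Civita product is the bilinear map $(X,Y)\mapsto\nabla_XY\in\mathfrak g$ determined by $2\langle\nabla_XY,Z\rangle=\langle[X,Y],Z\rangle-\langle[Y,Z],X\rangle+\langle[Z,X],Y\rangle$ for all $X,Y,Z\in\mathfrak g$. For subspaces $\mathfrak a,\mathfrak b\subseteq\mathfrak g$, $\nabla_{\mathfrak a}\mathfrak b$ is the linear span of all $\nabla_XY$ with $X\in\mathfrak a$, $Y\in\mathfrak b$. A subspace $\mathfrak h$ is a strong ideal if $\nabla_{\mathfrak g}\mathfrak h\subseteq\mathfrak h$ and $\nabla_{\mathfrak h}\mathfrak g\subseteq\mathfrak h$. In the direct sum Lie algebra, $[\mathfrak g_1,\mathfrak g_2]=0$. *)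

theory Defs
  imports "HOL-Analysis.Analysis"
begin

text \<open>A vector space is the universe of a type of class \<^class>\<open>real_vector\<close>; in contrast to
  \<^class>\<open>euclidean_space\<close>, this singles out no inner product and does not exclude dimension zero.
  The bracket and the bilinear form are explicit parameters.\<close>

definition finite_dim_space :: "'a::real_vector itself \<Rightarrow> bool" where
  "finite_dim_space _ \<longleftrightarrow> (\<exists>S::'a set. finite S \<and> span S = UNIV)"

definition lie_bracket :: "('a::real_vector \<Rightarrow> 'a \<Rightarrow> 'a) \<Rightarrow> bool" where
  "lie_bracket br \<longleftrightarrow>
     bilinear br \<and>
     (\<forall>X. br X X = 0) \<and>
     (\<forall>X Y Z. br X (br Y Z) + br Y (br Z X) + br Z (br X Y) = 0)"

definition symmetric_form :: "('a \<Rightarrow> 'a \<Rightarrow> real) \<Rightarrow> bool" where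
  "symmetric_form g \<longleftrightarrow> (\<forall>X Y. g X Y = g Y X)"

definition nondegenerate_form :: "('a::real_vector \<Rightarrow> 'a \<Rightarrow> real) \<Rightarrow> bool" where
  "nondegenerate_form g \<longleftrightarrow> (\<forall>X. (\<forall>Y. g X Y = 0) \<longrightarrow> X = 0)"

definition metric_lie_algebra :: "('a::real_vector \<Rightarrow> 'a \<Rightarrow> 'a) \<Rightarrow> ('a \<Rightarrow> 'a \<Rightarrow> real) \<Rightarrow> bool" where
  "metric_lie_algebra br g \<longleftrightarrow>
     finite_dim_space TYPE('a) \<and> lie_bracket br \<and>
     bilinear g \<and> symmetric_form g \<and> nondegenerate_form g"

text \<open>The vector described below exists and is unique for a metric Lie algebra, since its form is
  non-degenerate and its dimension finite.\<close>

definition levi_civita ::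
    "('a::real_vector \<Rightarrow> 'a \<Rightarrow> 'a) \<Rightarrow> ('a \<Rightarrow> 'a \<Rightarrow> real) \<Rightarrow> 'a \<Rightarrow> 'a \<Rightarrow> 'a" where
  "levi_civita br g X Y =
     (THE W. \<forall>Z. 2 * g W Z = g (br X Y) Z - g (br Y Z) X + g (br Z X) Y)"

definition levi_civita_span ::
    "('a::real_vector \<Rightarrow> 'a \<Rightarrow> 'a) \<Rightarrow> ('a \<Rightarrow> 'a \<Rightarrow> real) \<Rightarrow> 'a set \<Rightarrow> 'a set \<Rightarrow> 'a set" where
  "levi_civita_span br g A C = span {levi_civita br g X Y | X Y. X \<in> A \<and> Y \<in> C}"

definition strong_ideal ::
    "('a::real_vector \<Rightarrow> 'a \<Rightarrow> 'a) \<Rightarrow> ('a \<Rightarrow> 'a \<Rightarrow> real) \<Rightarrow> 'a set \<Rightarrow> bool" where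
  "strong_ideal br g H \<longleftrightarrow>
     subspace H \<and>
     levi_civita_span br g UNIV H \<subseteq> H \<and>
     levi_civita_span br g H UNIV \<subseteq> H"

text \<open>The direct sum is carried by the product type, \<open>X\<^sub>1 + X\<^sub>2\<close> being the pair \<open>(X\<^sub>1, X\<^sub>2)\<close>; the two
  summands are then \<open>UNIV \<times> {0}\<close> and \<open>{0} \<times> UNIV\<close>.\<close>

definition sum_bracket ::
    "('a \<Rightarrow> 'a \<Rightarrow> 'a) \<Rightarrow> ('b \<Rightarrow> 'b \<Rightarrow> 'b) \<Rightarrow> 'a \<times> 'b \<Rightarrow> 'a \<times> 'b \<Rightarrow> 'a \<times> 'b" where
  "sum_bracket br1 br2 X Y = (br1 (fst X) (fst Y), br2 (snd X) (snd Y))"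

definition sum_form ::
    "('a \<Rightarrow> 'a \<Rightarrow> real) \<Rightarrow> ('b \<Rightarrow> 'b \<Rightarrow> real) \<Rightarrow> ('a \<Rightarrow> 'b \<Rightarrow> real) \<Rightarrow>
     'a \<times> 'b \<Rightarrow> 'a \<times> 'b \<Rightarrow> real" where
  "sum_form g1 g2 B X Y =
     g1 (fst X) (fst Y) + g2 (snd X) (snd Y) + B (fst X) (snd Y) + B (fst Y) (snd X)"

end

theory Submission
  imports Defs
begin

text \<open>If both summands are strong ideals, then \<open>\<nabla>\<^bsub>X\<^esub> Z\<close> lies in their intersection, hence vanishes,
  whenever \<open>X\<close> and \<open>Z\<close> come from different summands. The Koszul formula turns this into
  \<open>\<langle>[Y, X], Z\<rangle> = 0\<close> for \<open>X, Y\<close> in one summand and \<open>Z\<close> in the other, and a second application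
  of the formula gives \<open>\<langle>\<nabla>\<^bsub>X\<^esub> Y, Z\<rangle> = 0\<close>, i.e. the condition on \<open>B\<close>. Conversely, each bracket
  \<open>[X, Y] = \<nabla>\<^bsub>X\<^esub> Y - \<nabla>\<^bsub>Y\<^esub> X\<close> lies in \<open>D\<^sub>i\<close>, so under the condition on \<open>B\<close> all mixed terms disappear
  from the Koszul formula, which is then solved by \<open>\<nabla>\<^sup>1 \<oplus> \<nabla>\<^sup>2\<close>.\<close>

section \<open>Existence and first properties of the Levi-Civita product\<close>

lemma nondegenerate_form_represents:
  fixes g :: "'a::real_vector \<Rightarrow> 'a \<Rightarrow> real"
  assumes "finite_dim_space TYPE('a)" and g: "bilinear g" "nondegenerate_form g"
    and \<phi>: "linear \<phi>"
  shows "\<exists>W. \<forall>Z. g W Z = \<phi> Z"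
proof -
  obtain S0 :: "'a set" where S0: "finite S0" "span S0 = UNIV"
    using assms(1) unfolding finite_dim_space_def by blast
  obtain S where S: "S \<subseteq> S0" "independent S" "S0 \<subseteq> span S"
    using maximal_independent_subset[of S0] by blast
  have fin: "finite S" and sp: "span S = UNIV"
    using S S0 finite_subset span_minimal[OF S(3) subspace_span] by auto
  \<comment> \<open>The type has only the class \<open>real_vector\<close>, so finite dimension
    enters through the basis \<open>S\<close>; it turns injectivity of \<open>T\<close> into
    surjectivity below.\<close>
  interpret fd: finite_dimensional_vector_space "scaleR :: real \<Rightarrow> 'a \<Rightarrow> 'a" S
    by unfold_locales (use fin sp S(2) in \<open>auto simp: dependent_raw_def span_raw_def\<close>)
  \<comment> \<open>The coordinates of \<open>T W\<close> are the values of \<open>g W\<close> on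
    the basis. Representing \<open>\<phi>\<close> thus means hitting the vector with coordinates
    \<open>\<phi> b\<close>, and non-degeneracy says that \<open>T\<close> has trivial
    kernel.\<close>
  define T where "T W = (\<Sum>b\<in>S. g W b *\<^sub>R b)" for W
  have g1: "linear (\<lambda>W. g W b)" and g2: "linear (g W)" for b W
    using g(1) by (auto simp: bilinear_def)
  have linT: "linear T"
    unfolding T_def
    by (intro linearI)
      (simp_all add: linear_add[OF g1] linear_scale[OF g1] scaleR_left_distrib sum.distrib scaleR_sum_right)
  have coeff: "u b = v b" if "(\<Sum>b\<in>S. u b *\<^sub>R b) = (\<Sum>b\<in>S. v b *\<^sub>R b)" "b \<in> S" for u v b
  proof -
    have "(\<Sum>b\<in>S. (u b - v b) *\<^sub>R b) = 0"
      using that(1) by (simp add: scaleR_left_diff_distrib sum_subtractf)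
    then show ?thesis
      using independentD[OF S(2) fin subset_refl _ that(2)] by fastforce
  qed
  have ext: "g W Z = \<psi> Z" if "linear \<psi>" "\<And>b. b \<in> S \<Longrightarrow> g W b = \<psi> b" for W Z \<psi>
    using linear_eq_on_span[OF g2 that(1) that(2)] sp by blast
  have "inj T"
    unfolding linear_injective_0[OF linT]
  proof (intro allI impI)
    fix W assume "T W = 0"
    then have "g W b = 0" if "b \<in> S" for b
      using coeff[of "g W" "\<lambda>_. 0"] that by (simp add: T_def)
    then have "\<forall>Z. g W Z = 0"
      using ext[of "\<lambda>_. 0"] by (simp add: linear_zero)
    then show "W = 0"
      using g(2) by (simp add: nondegenerate_form_def)
  qed
  then have "surj T"
    using fd.linear_inj_imp_surj[of T] linT by (simp add: linear_def)
  then obtain W where "T W = (\<Sum>b\<in>S. \<phi> b *\<^sub>R b)"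
    by (metis surjD)
  then have "g W b = \<phi> b" if "b \<in> S" for b
    using coeff[of "g W" \<phi>] that by (simp add: T_def)
  then show ?thesis
    using ext[OF \<phi>] by blast
qed

text \<open>Two solutions of the Koszul formula differ by a vector orthogonal to everything, which
  non-degeneracy forces to be \<open>0\<close>. A product can therefore be identified by checking
  the formula on a candidate.\<close>

lemma levi_civita_eqI:
  assumes "bilinear g" "nondegenerate_form g"
    and W: "\<And>Z. 2 * g W Z = g (br X Y) Z - g (br Y Z) X + g (br Z X) Y"
  shows "levi_civita br g X Y = W"
  unfolding levi_civita_def
proof (rule the_equality)
  fix V assume V: "\<forall>Z. 2 * g V Z = g (br X Y) Z - g (br Y Z) X + g (br Z X) Y"
  have "g (V - W) Z = 0" for Z
    using V W[of Z] bilinear_lsub[OF assms(1), of V W Z] by (smt (verit))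
  then show "V = W"
    using assms(2) unfolding nondegenerate_form_def by (metis eq_iff_diff_eq_0)
qed (use W in blast)

text \<open>Half of the right-hand side is linear in \<open>Z\<close>, so the form represents it by
  some vector, and uniqueness identifies this vector with the Levi-Civita product.\<close>

lemma koszul:
  fixes g :: "'a::real_vector \<Rightarrow> 'a \<Rightarrow> real"
  assumes "metric_lie_algebra br g"
  shows "2 * g (levi_civita br g X Y) Z = g (br X Y) Z - g (br Y Z) X + g (br Z X) Y"
proof -
  have g: "bilinear g" "nondegenerate_form g" and fd: "finite_dim_space TYPE('a)" and br: "bilinear br"
    using assms by (auto simp: metric_lie_algebra_def lie_bracket_def)
  define \<phi> where "\<phi> Z = (g (br X Y) Z - g (br Y Z) X + g (br Z X) Y) / 2" for Z
  have "linear \<phi>"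
    unfolding \<phi>_def
    by (intro linearI)
      (simp_all add: bilinear_ladd[OF g(1)] bilinear_radd[OF g(1)] bilinear_lmul[OF g(1)]
        bilinear_rmul[OF g(1)] bilinear_ladd[OF br] bilinear_radd[OF br] bilinear_lmul[OF br]
        bilinear_rmul[OF br] field_simps)
  then obtain W where "\<And>Z. g W Z = \<phi> Z"
    using nondegenerate_form_represents[OF fd g] by blast
  then have W: "2 * g W Z = g (br X Y) Z - g (br Y Z) X + g (br Z X) Y" for Z
    by (simp add: \<phi>_def mult.commute)
  then show ?thesis
    using levi_civita_eqI[OF g W] by simp
qed

lemma lie_bracket_swap:
  assumes "lie_bracket br"
  shows "br X Y = - br Y X"
proof -
  have b: "bilinear br" and z: "br V V = 0" for V
    using assms by (auto simp: lie_bracket_def)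
  have "br X Y + br Y X = 0"
    using z[of "X + Y"] by (simp add: bilinear_ladd[OF b] bilinear_radd[OF b] z[of X] z[of Y] add.commute)
  then show ?thesis
    by (simp add: eq_neg_iff_add_eq_0)
qed

text \<open>On subtracting the Koszul formulas for \<open>X, Y\<close> and \<open>Y, X\<close>,
  antisymmetry of the bracket cancels all terms but those in \<open>br X Y\<close>. The result
  places every bracket in the span of the products.\<close>

lemma levi_civita_torsion_free:
  assumes m: "metric_lie_algebra br g"
  shows "br X Y = levi_civita br g X Y - levi_civita br g Y X"
proof -
  have g: "bilinear g" and nd: "nondegenerate_form g" and L: "lie_bracket br"
    using m by (auto simp: metric_lie_algebra_def)
  have "g (levi_civita br g X Y - levi_civita br g Y X - br X Y) Z = 0" for Z
    using koszul[OF m, of X Y Z] koszul[OF m, of Y X Z]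
      lie_bracket_swap[OF L, of Y X] lie_bracket_swap[OF L, of Z Y] lie_bracket_swap[OF L, of Z X]
    by (simp add: bilinear_lsub[OF g] bilinear_lneg[OF g])
  then show ?thesis
    using nd unfolding nondegenerate_form_def by (metis eq_iff_diff_eq_0)
qed

lemma levi_civita_zero:
  assumes m: "metric_lie_algebra br g"
  shows "levi_civita br g X 0 = 0" "levi_civita br g 0 X = 0"
proof -
  have g: "bilinear g" and nd: "nondegenerate_form g" and b: "bilinear br"
    using m by (auto simp: metric_lie_algebra_def lie_bracket_def)
  note z = bilinear_lzero[OF g] bilinear_rzero[OF g] bilinear_lzero[OF b] bilinear_rzero[OF b]
  show "levi_civita br g X 0 = 0" "levi_civita br g 0 X = 0"
    by (rule levi_civita_eqI[OF g nd]; simp add: z)+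
qed

section \<open>Strong ideals and their mutual orthogonality relations\<close>

lemma strong_ideal_levi_civita:
  assumes "strong_ideal br g H" "X \<in> H"
  shows "levi_civita br g X Y \<in> H" "levi_civita br g Y X \<in> H"
proof -
  have "levi_civita br g X Y \<in> levi_civita_span br g H UNIV"
    "levi_civita br g Y X \<in> levi_civita_span br g UNIV H"
    unfolding levi_civita_span_def using assms(2) by (blast intro: span_base)+
  then show "levi_civita br g X Y \<in> H" "levi_civita br g Y X \<in> H"
    using assms(1) unfolding strong_ideal_def by blast+
qed

lemma strong_idealI:
  assumes "subspace H" "\<And>X Y. X \<in> H \<Longrightarrow> levi_civita br g X Y \<in> H"
    "\<And>X Y. X \<in> H \<Longrightarrow> levi_civita br g Y X \<in> H"
  shows "strong_ideal br g H"
  unfolding strong_ideal_def levi_civita_span_def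
  using assms by (intro conjI span_minimal) blast+

text \<open>Phrased for abstract commuting strong ideals, so that it applies to the two summands in
  either order.\<close>

lemma levi_civita_orthogonal_strong_ideals:
  assumes m: "metric_lie_algebra br g"
    and H: "strong_ideal br g H" and K: "strong_ideal br g K"
    and HK: "H \<inter> K = {0}" and comm: "\<And>X Z. X \<in> H \<Longrightarrow> Z \<in> K \<Longrightarrow> br X Z = 0"
    and X: "X \<in> H" and Y: "Y \<in> H" and Z: "Z \<in> K"
  shows "g (levi_civita br g X Y) Z = 0"
proof -
  have g: "bilinear g" and L: "lie_bracket br"
    using m by (auto simp: metric_lie_algebra_def)
  have comm': "br V U = 0" if "U \<in> H" "V \<in> K" for U V
    using comm[OF that] lie_bracket_swap[OF L, of V U] by simp
  have "levi_civita br g X Z = 0"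
    using strong_ideal_levi_civita[OF H X, of Z] strong_ideal_levi_civita[OF K Z, of X] HK by blast
  \<comment> \<open>In the Koszul formula for \<open>X, Z, Y\<close> the left side is
    \<open>0\<close>, and the brackets of \<open>X\<close> with \<open>Z\<close> and of
    \<open>Z\<close> with \<open>Y\<close> vanish.\<close>
  then have "g (br Y X) Z = 0"
    using koszul[OF m, of X Z Y] comm X comm' Y Z by (simp add: bilinear_lzero[OF g])
  then have "g (br X Y) Z = 0"
    using lie_bracket_swap[OF L, of X Y] by (simp add: bilinear_lneg[OF g])
  then show ?thesis
    using koszul[OF m, of X Y Z] comm comm' X Y Z by (simp add: bilinear_lzero[OF g])
qed

section \<open>The direct sum as a metric Lie algebra\<close>

lemma finite_dim_space_prod:
  assumes "finite_dim_space TYPE('a::real_vector)" "finite_dim_space TYPE('b::real_vector)"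
  shows "finite_dim_space TYPE('a \<times> 'b)"
proof -
  obtain S :: "'a set" and T :: "'b set"
    where S: "finite S" "span S = UNIV" and T: "finite T" "span T = UNIV"
    using assms unfolding finite_dim_space_def by blast
  let ?f = "\<lambda>x::'a. (x, 0::'b)" and ?h = "\<lambda>y::'b. (0::'a, y)"
  let ?U = "?f ` S \<union> ?h ` T"
  have lin: "linear ?f" "linear ?h"
    by (auto intro!: linearI)
  have f: "?f x \<in> span ?U" for x
    using linear_span_image[OF lin(1), of S] S(2) span_mono[of "?f ` S" ?U] by blast
  have h: "?h y \<in> span ?U" for y
    using linear_span_image[OF lin(2), of T] T(2) span_mono[of "?h ` T" ?U] by blast
  have "p \<in> span ?U" for p
    using span_add[OF f[of "fst p"] h[of "snd p"]] by simp
  then show ?thesis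
    unfolding finite_dim_space_def using S(1) T(1) by (intro exI[of _ ?U]) auto
qed

lemma lie_bracket_sum_bracket:
  assumes "lie_bracket br1" "lie_bracket br2"
  shows "lie_bracket (sum_bracket br1 br2)"
proof -
  have b: "bilinear br1" "bilinear br2"
    using assms by (auto simp: lie_bracket_def)
  have "bilinear (sum_bracket br1 br2)"
    unfolding bilinear_def sum_bracket_def
    by (auto intro!: linearI simp: bilinear_ladd[OF b(1)] bilinear_radd[OF b(1)]
        bilinear_lmul[OF b(1)] bilinear_rmul[OF b(1)] bilinear_ladd[OF b(2)]
        bilinear_radd[OF b(2)] bilinear_lmul[OF b(2)] bilinear_rmul[OF b(2)])
  then show ?thesis
    using assms by (auto simp: lie_bracket_def sum_bracket_def prod_eq_iff)
qed

lemma bilinear_sum_form: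
  assumes b: "bilinear g1" "bilinear g2" "bilinear B"
  shows "bilinear (sum_form g1 g2 B)"
  unfolding bilinear_def sum_form_def
  by (auto intro!: linearI simp: bilinear_ladd[OF b(1)] bilinear_radd[OF b(1)]
      bilinear_lmul[OF b(1)] bilinear_rmul[OF b(1)] bilinear_ladd[OF b(2)]
      bilinear_radd[OF b(2)] bilinear_lmul[OF b(2)] bilinear_rmul[OF b(2)]
      bilinear_ladd[OF b(3)] bilinear_radd[OF b(3)] bilinear_lmul[OF b(3)]
      bilinear_rmul[OF b(3)] algebra_simps)

lemma metric_lie_algebra_sum:
  assumes "metric_lie_algebra br1 g1" "metric_lie_algebra br2 g2" "bilinear B"
    "nondegenerate_form (sum_form g1 g2 B)"
  shows "metric_lie_algebra (sum_bracket br1 br2) (sum_form g1 g2 B)"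
  using assms finite_dim_space_prod lie_bracket_sum_bracket bilinear_sum_form
  by (auto simp: metric_lie_algebra_def symmetric_form_def sum_form_def)

lemma levi_civita_mem_span: "levi_civita br g X Y \<in> levi_civita_span br g UNIV UNIV"
  unfolding levi_civita_span_def by (rule span_base) blast

text \<open>Applied to \<open>B\<close> with one argument fixed, this reduces the conditions on
  \<open>D1\<close> and \<open>D2\<close> to single products.\<close>

lemma linear_eq_0_on_levi_civita_span:
  assumes "linear f" "\<And>X Y. f (levi_civita br g X Y) = 0"
    and "V \<in> levi_civita_span br g UNIV UNIV"
  shows "f V = 0"
  using linear_eq_0_on_span[OF assms(1) _ assms(3)[unfolded levi_civita_span_def]] assms(2) by blast

section \<open>The criterion for both summands to be strong ideals\<close>

theorem proposition2p5:
  fixes br1 :: "'a::real_vector \<Rightarrow> 'a \<Rightarrow> 'a" and g1 :: "'a \<Rightarrow> 'a \<Rightarrow> real"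
    and br2 :: "'b::real_vector \<Rightarrow> 'b \<Rightarrow> 'b" and g2 :: "'b \<Rightarrow> 'b \<Rightarrow> real"
    and B :: "'a \<Rightarrow> 'b \<Rightarrow> real"
  defines "br \<equiv> sum_bracket br1 br2"
    and "gB \<equiv> sum_form g1 g2 B"
    and "D1 \<equiv> levi_civita_span br1 g1 UNIV UNIV"
    and "D2 \<equiv> levi_civita_span br2 g2 UNIV UNIV"
  assumes "metric_lie_algebra br1 g1"
    and "metric_lie_algebra br2 g2"
    and "bilinear B"
    and "nondegenerate_form gB"
  shows "(strong_ideal br gB (UNIV \<times> {0}) \<and> strong_ideal br gB ({0} \<times> UNIV)
            \<longleftrightarrow> (\<forall>X\<in>D1. \<forall>Y. B X Y = 0) \<and> (\<forall>X. \<forall>Y\<in>D2. B X Y = 0))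
       \<and> (strong_ideal br gB (UNIV \<times> {0}) \<and> strong_ideal br gB ({0} \<times> UNIV)
            \<longrightarrow> (\<forall>X1 X2 Y1 Y2. levi_civita br gB (X1, X2) (Y1, Y2)
                  = (levi_civita br1 g1 X1 Y1, levi_civita br2 g2 X2 Y2)))"
proof -
  note m1 = assms(5) and m2 = assms(6) and B = assms(7) and nd = assms(8)
  have m: "metric_lie_algebra br gB"
    using metric_lie_algebra_sum[OF m1 m2 B] nd unfolding br_def gB_def by simp
  have gB: "bilinear gB" and g1: "bilinear g1" and g2: "bilinear g2"
    and nd1: "nondegenerate_form g1" and nd2: "nondegenerate_form g2"
    and b1: "bilinear br1" and b2: "bilinear br2"
    using m m1 m2 by (auto simp: metric_lie_algebra_def lie_bracket_def)
  note zero = bilinear_lzero[OF B] bilinear_rzero[OF B] bilinear_lzero[OF g1] bilinear_rzero[OF g1]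
    bilinear_lzero[OF g2] bilinear_rzero[OF g2] bilinear_lzero[OF b1] bilinear_rzero[OF b1]
    bilinear_lzero[OF b2] bilinear_rzero[OF b2]
  let ?H1 = "UNIV \<times> {0} :: ('a \<times> 'b) set" and ?H2 = "{0} \<times> UNIV :: ('a \<times> 'b) set"
  let ?ideals = "strong_ideal br gB ?H1 \<and> strong_ideal br gB ?H2"
  let ?cond = "(\<forall>X\<in>D1. \<forall>Y. B X Y = 0) \<and> (\<forall>X. \<forall>Y\<in>D2. B X Y = 0)"
  have B1: "linear (\<lambda>X. B X Z)" and B2: "linear (B Z')" for Z Z'
    using B by (auto simp: bilinear_def)
  have nec: ?cond if "?ideals"
  proof -
    have H1: "strong_ideal br gB ?H1" and H2: "strong_ideal br gB ?H2"
      using that by auto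
    have "B (levi_civita br1 g1 X Y) Z = 0" for X Y Z
    proof -
      let ?N = "levi_civita br gB (X, 0) (Y, 0)"
      have N: "snd ?N = 0"
        using strong_ideal_levi_civita(1)[OF H1, of "(X, 0)" "(Y, 0)"] by (auto simp: prod_eq_iff)
      \<comment> \<open>As \<open>?N\<close> has second component \<open>0\<close>, testing against
        \<open>(U, 0)\<close> leaves no term in \<open>g2\<close> or \<open>B\<close>: this is the
        Koszul formula of the first summand.\<close>
      have "2 * g1 (fst ?N) U = g1 (br1 X Y) U - g1 (br1 Y U) X + g1 (br1 U X) Y" for U
        using koszul[OF m, of "(X, 0)" "(Y, 0)" "(U, 0)"] N
        by (simp add: gB_def br_def sum_form_def sum_bracket_def zero)
      then have "levi_civita br1 g1 X Y = fst ?N"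
        by (rule levi_civita_eqI[OF g1 nd1])
      \<comment> \<open>For \<open>?N\<close> in the first summand this pairing is just
        \<open>B (fst ?N) Z\<close>.\<close>
      moreover have "gB ?N (0, Z) = 0"
        by (rule levi_civita_orthogonal_strong_ideals[OF m H1 H2])
          (auto simp: br_def sum_bracket_def zero prod_eq_iff)
      ultimately show ?thesis
        using N by (simp add: gB_def sum_form_def zero)
    qed
    moreover have "B Z (levi_civita br2 g2 X Y) = 0" for X Y Z
    proof -
      let ?N = "levi_civita br gB (0, X) (0, Y)"
      have N: "fst ?N = 0"
        using strong_ideal_levi_civita(1)[OF H2, of "(0, X)" "(0, Y)"] by (auto simp: prod_eq_iff)
      have "2 * g2 (snd ?N) U = g2 (br2 X Y) U - g2 (br2 Y U) X + g2 (br2 U X) Y" for U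
        using koszul[OF m, of "(0, X)" "(0, Y)" "(0, U)"] N
        by (simp add: gB_def br_def sum_form_def sum_bracket_def zero)
      then have "levi_civita br2 g2 X Y = snd ?N"
        by (rule levi_civita_eqI[OF g2 nd2])
      moreover have "gB ?N (Z, 0) = 0"
        by (rule levi_civita_orthogonal_strong_ideals[OF m H2 H1])
          (auto simp: br_def sum_bracket_def zero prod_eq_iff)
      ultimately show ?thesis
        using N by (simp add: gB_def sum_form_def zero)
    qed
    ultimately show ?thesis
      unfolding D1_def D2_def
      using linear_eq_0_on_levi_civita_span[OF B1] linear_eq_0_on_levi_civita_span[OF B2] by blast
  qed
  have lc: "levi_civita br gB (X1, X2) (Y1, Y2) = (levi_civita br1 g1 X1 Y1, levi_civita br2 g2 X2 Y2)"
    if ?cond for X1 X2 Y1 Y2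
  proof -
    have n1: "B (levi_civita br1 g1 X Y) Z = 0" and n2: "B Z' (levi_civita br2 g2 X' Y') = 0"
      for X Y Z X' Y' Z'
      using that by (simp_all add: D1_def D2_def levi_civita_mem_span)
    have c1: "B (br1 X Y) Z = 0" for X Y Z
      using levi_civita_torsion_free[OF m1, of X Y] n1 by (simp add: bilinear_lsub[OF B])
    have c2: "B Z (br2 X Y) = 0" for X Y Z
      using levi_civita_torsion_free[OF m2, of X Y] n2 by (simp add: bilinear_rsub[OF B])
    show ?thesis
    proof (rule levi_civita_eqI[OF gB nd])
      fix Z
      \<comment> \<open>\<open>n1\<close>, \<open>n2\<close> remove the mixed terms on the left and
        \<open>c1\<close>, \<open>c2\<close> those on the right; what remains is the sum of the two
        Koszul formulas.\<close>
      show "2 * gB (levi_civita br1 g1 X1 Y1, levi_civita br2 g2 X2 Y2) Z =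
        gB (br (X1, X2) (Y1, Y2)) Z - gB (br (Y1, Y2) Z) (X1, X2) + gB (br Z (X1, X2)) (Y1, Y2)"
        using koszul[OF m1, of X1 Y1 "fst Z"] koszul[OF m2, of X2 Y2 "snd Z"]
        by (simp add: gB_def br_def sum_form_def sum_bracket_def n1 n2 c1 c2)
    qed
  qed
  have suf: "?ideals" if ?cond
  proof -
    have lc': "levi_civita br gB X Y =
        (levi_civita br1 g1 (fst X) (fst Y), levi_civita br2 g2 (snd X) (snd Y))" for X Y
      using lc[OF that, of "fst X" "snd X" "fst Y" "snd Y"] by simp
    \<comment> \<open>If one factor has second component \<open>0\<close>, so does the product,
      because \<nabla> of the second summand vanishes when either argument is
      \<open>0\<close>.\<close>
    have "strong_ideal br gB ?H1"
      by (rule strong_idealI)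
        (simp_all add: subspace_def mem_Times_iff lc' levi_civita_zero[OF m2])
    moreover have "strong_ideal br gB ?H2"
      by (rule strong_idealI)
        (simp_all add: subspace_def mem_Times_iff lc' levi_civita_zero[OF m1])
    ultimately show ?thesis ..
  qed
  have "?ideals \<longleftrightarrow> ?cond"
    using nec suf by (rule iffI)
  \<comment> \<open>The equivalence moves \<open>lc\<close> from the hypothesis \<open>?cond\<close>
    to the hypothesis \<open>?ideals\<close>.\<close>
  then show ?thesis
    using lc by simp
qed

end
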